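(* Let $p_1,p_2$ be different prime numbers, and let $n_1,n_2,n_3$ be positive integers such that $n_1p_1$ is coprime with $n_2p_2$ and $n_1p_1$ is coprime with $n_2n_3$. Put $N=n_1n_2n_3p_1p_2$. Let $H$ be the subgroup $H=p_2\mathbb{I}_{n_1n_2n_3p_1}$ of $\mathbb{Z}_N$, and let $K$ be a complete set of coset representatives for $\mathbb{Z}_N$ modulo $H$, written as a disjoint union $K=K_1\cup K_2$. Define subsets of $\mathbb{Z}_N$ by $$A=n_1p_1p_2\mathbb{I}_{n_2},\qquad B=n_2n_3p_2\mathbb{I}_{n_1},$$ $$U=n_1n_2p_1p_2\mathbb{I}_{n_3},\qquad V=n_1n_2n_3p_2\mathbb{I}_{p_1},$$ $$U'=n_2p_2\mathbb{I}_{n_3},\qquad V'=n_1p_2\mathbb{I}_{p_1}.$$ Let $$S=A+B,\qquad R=(U+V'+K_1)\cup(U'+V+K_2).$$ If $R$ is a non-periodic subset of $\mathbb{Z}_N$, then $(S,R)$ is a Vuza canon of $\mathbb{Z}_N$.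
   Context: $\mathbb{Z}_N=\{0,1,\dots,N-1\}$ denotes the cyclic group of order $N$ (addition modulo $N$). For positive integers $k,a$, $k\mathbb{I}_a=\{0,\ k\bmod N,\ 2k\bmod N,\dots,(a-1)k\bmod N\}\subseteq\mathbb{Z}_N$. Sums of subsets are $X+Y=\{x+y:x\in X,y\in Y\}$. For non-empty subsets $S,R$ of a finite cyclic group $G$, $G=S\oplus R$ means that every $g\in G$ can be written uniquely as $g=s+r$ with $s\in S$, $r\in R$. A non-empty subset $T$ of $G$ is periodic if there is $g\in G$, $g\neq0$, with $T+g=T$; otherwise it is non-periodic. A Vuza canon of $G$ is a pair $(S,R)$ of non-empty subsets of $G$ such that $G=S\oplus R$ and neither $S$ nor $R$ is periodic.
   Formalization: The formal theorem adds the hypothesis n_2 = 1 or n_3 ≥ 2; if n_3 = 1 < n_2 then A is a nontrivial subgroup, so S is periodic and the claim fails (e.g. p_1=3, p_2=2, n_1=1, n_2=2, n_3=1, K_1={0}, K_2={1} in Z_12). *)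

theory Defs
  imports "HOL-Algebra.Elementary_Groups" "HOL-Computational_Algebra.Primes"
begin

(* The cyclic group of order N (N > 0) is integer_mod_group N, whose carrier is {0..<int N}; its
   operation + is written \<otimes>, its 0 is \<one>, X + Y for subsets is set_mult (<#>), and T + g is T #> g. *)

definition mod_progression :: "nat \<Rightarrow> nat \<Rightarrow> nat \<Rightarrow> int set" where
  "mod_progression N k a = (\<lambda>i. int (i * k) mod int N) ` {..<a}"

definition factorization :: "('a, 'b) monoid_scheme \<Rightarrow> 'a set \<Rightarrow> 'a set \<Rightarrow> bool" where
  "factorization G S R \<longleftrightarrow>
     S \<subseteq> carrier G \<and> R \<subseteq> carrier G \<and> S \<noteq> {} \<and> R \<noteq> {} \<and>
     (\<forall>g\<in>carrier G. \<exists>!sr. sr \<in> S \<times> R \<and> g = fst sr \<otimes>\<^bsub>G\<^esub> snd sr)"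

definition periodic :: "('a, 'b) monoid_scheme \<Rightarrow> 'a set \<Rightarrow> bool" where
  "periodic G T \<longleftrightarrow> (\<exists>g\<in>carrier G. g \<noteq> \<one>\<^bsub>G\<^esub> \<and> T #>\<^bsub>G\<^esub> g = T)"

definition vuza_canon :: "('a, 'b) monoid_scheme \<Rightarrow> 'a set \<Rightarrow> 'a set \<Rightarrow> bool" where
  "vuza_canon G S R \<longleftrightarrow> factorization G S R \<and> \<not> periodic G S \<and> \<not> periodic G R"

definition coset_representatives :: "('a, 'b) monoid_scheme \<Rightarrow> 'a set \<Rightarrow> 'a set \<Rightarrow> bool" where
  "coset_representatives G H K \<longleftrightarrow>
     K \<subseteq> carrier G \<and> (\<forall>C\<in>rcosets\<^bsub>G\<^esub> H. \<exists>!k. k \<in> K \<inter> C)"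

end

theory Submission
  imports Defs "HOL-Number_Theory.Cong"
begin

text \<open>
  The subgroup \<open>H\<close> consists of the multiples of \<open>p2\<close>; dividing by \<open>p2\<close> identifies it with the residues
  modulo \<open>(n1 * p1) * (n2 * n3)\<close>, and the two bracketed factors are coprime. There \<open>A + U\<close> is the
  subgroup of multiples of \<open>n1 * p1\<close>, written in mixed radix with digits below \<open>n2\<close> and \<open>n3\<close>, and
  \<open>B + V\<close> is the subgroup of multiples of \<open>n2 * n3\<close>, with digits below \<open>n1\<close> and \<open>p1\<close>. So
  \<open>S = A + B\<close> is complemented in \<open>H\<close> by \<open>U + V\<close>. It remains complemented when \<open>V\<close> is replaced by \<open>V'\<close>,
  because both have the same residues modulo \<open>n1 * p1\<close>, and likewise when \<open>U\<close> is replaced by \<open>U'\<close>,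
  because both have the same residues modulo \<open>n2 * n3\<close>. The two replacements are one statement,
  \<open>factorization_of_multiples\<close>, since exchanging \<open>(n1, p1)\<close> with \<open>(n2, n3)\<close> turns one into the other.

  As both \<open>U + V'\<close> and \<open>U' + V\<close> complement \<open>S\<close> in \<open>H\<close>, either of them may be used in each coset of
  \<open>H\<close> (\<open>factorization_glued_from_cosets\<close>), which gives the factorization of the whole group.

  Splitting residues into their parts modulo \<open>n2 * n3\<close> and modulo \<open>n1 * p1\<close> makes \<open>S\<close> a product of
  two digit blocks, which up to units are \<open>{0, \<dots>, n2 - 1}\<close> and \<open>{0, \<dots>, n1 - 1}\<close>. A proper block of
  consecutive residues has no period, and both blocks are proper because \<open>n3 \<ge> 2\<close> and \<open>p1 \<ge> 2\<close>; in the
  remaining case \<open>n2 = n3 = 1\<close> the first modulus is \<open>1\<close> and leaves no room for a nonzero period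
  (\<open>sum_of_progressions_not_periodic\<close>).
\<close>

section \<open>Factorizations glued from cosets\<close>

text \<open>
  Every \<open>g\<close> lies in the coset of exactly one representative \<open>k\<close>, so in \<open>g = s \<otimes> (t \<otimes> k)\<close> the
  element \<open>k\<close> is determined by \<open>g\<close> alone, and \<open>s \<otimes> t = g \<otimes> inv k\<close> is a factorization inside \<open>H\<close>.
  Hence the second factor may be chosen anew in every coset, as long as all choices complement the
  same \<open>S\<close>; this freedom is what allows the union to be non-periodic.
\<close>

lemma factorization_glued_from_cosets:
  fixes G (structure)
  assumes "group G" and H: "subgroup H G" and K: "coset_representatives G H K"
    and T: "\<And>k. k \<in> K \<Longrightarrow> factorization (G\<lparr>carrier := H\<rparr>) S (T k)"
  shows "factorization G S (\<Union>k\<in>K. T k #> k)"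
proof -
  interpret group G by fact
  have HG: "H \<subseteq> carrier G" using H by (rule subgroup.subset)
  have KG: "k \<in> carrier G" if "k \<in> K" for k
    using K that by (auto simp: coset_representatives_def)
  have SH: "S \<subseteq> H" "S \<noteq> {}" and TH: "T k \<subseteq> H" if "k \<in> K" for k
    using T[OF that] by (auto simp: factorization_def)
  have rep: "\<exists>!k. k \<in> K \<inter> (H #> g)" if "g \<in> carrier G" for g
    using K that rcosetsI[OF HG that] by (auto simp: coset_representatives_def)
  obtain k0 where k0: "k0 \<in> K" using rep[OF one_closed] by blast
  have unique: "\<exists>!sr. sr \<in> S \<times> (\<Union>k\<in>K. T k #> k) \<and> g = fst sr \<otimes> snd sr"
    if g: "g \<in> carrier G" for g
  proof -
    obtain k where k: "k \<in> K" "k \<in> H #> g"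
      and k_unique: "\<And>k'. k' \<in> K \<Longrightarrow> k' \<in> H #> g \<Longrightarrow> k' = k"
      using rep[OF g] by blast
    have coset: "g \<in> H #> k"
      using k(2) g H by (metis rcos_self repr_independence)
    then obtain h where h: "h \<in> H" "g = h \<otimes> k" by (auto simp: r_coset_def)
    have ex: "\<exists>!sr. sr \<in> S \<times> T k \<and> h = fst sr \<otimes> snd sr"
      using T[OF k(1)] h(1) by (simp add: factorization_def)
    obtain s t where st: "s \<in> S" "t \<in> T k" "h = s \<otimes> t"
      using ex1_implies_ex[OF ex] by auto
    have mem: "s \<in> carrier G" "t \<in> carrier G"
      using st SH TH k(1) HG by blast+
    show ?thesis
    proof (rule ex1I[of _ "(s, t \<otimes> k)"])
      show "(s, t \<otimes> k) \<in> S \<times> (\<Union>k\<in>K. T k #> k) \<and> g = fst (s, t \<otimes> k) \<otimes> snd (s, t \<otimes> k)"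
        using st h k mem KG by (auto simp: r_coset_def m_assoc)
    next
      fix sr assume sr: "sr \<in> S \<times> (\<Union>k\<in>K. T k #> k) \<and> g = fst sr \<otimes> snd sr"
      then obtain s' t' k' where eq: "sr = (s', t' \<otimes> k')" "s' \<in> S" "k' \<in> K" "t' \<in> T k'"
        by (auto simp: r_coset_def)
      have H': "s' \<in> H" "t' \<in> H" using eq SH TH by blast+
      then have mem': "s' \<in> carrier G" "t' \<in> carrier G" "k' \<in> carrier G"
        using HG KG eq(3) by blast+
      have g': "g = (s' \<otimes> t') \<otimes> k'" using sr eq(1) mem' by (simp add: m_assoc)
      have "s' \<otimes> t' \<in> H" using H H' by (rule subgroup.m_closed)
      then have "g \<in> H #> k'" using g' by (auto simp: r_coset_def)
      then have "k' \<in> H #> g"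
        using mem' H by (metis rcos_self repr_independence)
      then have "k' = k" using k_unique eq(3) by blast
      moreover have "h = s' \<otimes> t'"
        using g' h \<open>k' = k\<close> mem' HG \<open>s' \<otimes> t' \<in> H\<close> by (metis right_cancel subsetD)
      ultimately have "(s', t') = (s, t)"
        using Uniq_D[OF conjunct2[OF ex[unfolded ex1_iff_ex_Uniq]], of "(s', t')" "(s, t)"]
          st eq by simp
      then show "sr = (s, t \<otimes> k)" using eq \<open>k' = k\<close> by simp
    qed
  qed
  have "(\<Union>k\<in>K. T k #> k) \<subseteq> carrier G"
    using TH HG KG by (fastforce simp: r_coset_def)
  moreover have "S \<subseteq> carrier G" "S \<noteq> {}" using SH[OF k0] HG by blast+
  moreover have "(\<Union>k\<in>K. T k #> k) \<noteq> {}" using unique[OF one_closed] by blast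
  ultimately show ?thesis using unique by (simp add: factorization_def)
qed

lemma factorization_if_bij_betw:
  assumes bij: "bij_betw (\<lambda>(i, j). f i \<otimes>\<^bsub>G\<^esub> g j) (I \<times> J) (carrier G)"
    and "f ` I \<subseteq> carrier G" "g ` J \<subseteq> carrier G" "I \<noteq> {}" "J \<noteq> {}"
  shows "factorization G (f ` I) (g ` J)"
proof -
  have "\<exists>!sr. sr \<in> f ` I \<times> g ` J \<and> x = fst sr \<otimes>\<^bsub>G\<^esub> snd sr" if "x \<in> carrier G" for x
  proof -
    have "x \<in> (\<lambda>(i, j). f i \<otimes>\<^bsub>G\<^esub> g j) ` (I \<times> J)"
      unfolding bij_betw_imp_surj_on[OF bij] by (rule that)
    then obtain i j where ij: "i \<in> I" "j \<in> J" "x = f i \<otimes>\<^bsub>G\<^esub> g j"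
      by (elim imageE SigmaE) simp
    show ?thesis
    proof (rule ex1I[of _ "(f i, g j)"])
      fix sr assume "sr \<in> f ` I \<times> g ` J \<and> x = fst sr \<otimes>\<^bsub>G\<^esub> snd sr"
      then obtain i' j' where "i' \<in> I" "j' \<in> J" "sr = (f i', g j')" "x = f i' \<otimes>\<^bsub>G\<^esub> g j'"
        by auto
      then show "sr = (f i, g j)"
        using ij inj_onD[OF bij_betw_imp_inj_on[OF bij], of "(i, j)" "(i', j')"] by simp
    qed (use ij in auto)
  qed
  then show ?thesis using assms by (simp add: factorization_def)
qed

section \<open>Sums of two progressions\<close>

lemma set_mult_mod_progression:
  "mod_progression N k a <#>\<^bsub>integer_mod_group N\<^esub> mod_progression N l b =
    (\<lambda>(i, j). int (i * k + j * l) mod int N) ` ({..<a} \<times> {..<b})"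
proof -
  have "(int (i * k) mod int N + int (j * l) mod int N) mod int N = int (i * k + j * l) mod int N" for i j
    by (simp add: mod_simps)
  then show ?thesis
    by (auto simp: mod_progression_def set_mult_def image_iff Bex_def simp del: of_nat_mult of_nat_add)
qed

lemma set_mult_mod_progression_commute:
  "mod_progression N k a <#>\<^bsub>integer_mod_group N\<^esub> mod_progression N l b =
    mod_progression N l b <#>\<^bsub>integer_mod_group N\<^esub> mod_progression N k a"
  unfolding set_mult_def mult_integer_mod_group by (subst add.commute) blast

lemma mod_progression_eq_multiples:
  assumes "m > 0" "M > 0"
  shows "mod_progression (M * m) m M = (\<lambda>i. int (i * m)) ` {..<M}"
  unfolding mod_progression_def using assms by (intro image_cong) auto

lemma subgroup_mod_progression:
  assumes "m > 0" "M > 0"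
  shows "subgroup (mod_progression (M * m) m M) (integer_mod_group (M * m))"
proof -
  let ?G = "integer_mod_group (M * m)"
  have H: "mod_progression (M * m) m M = {x \<in> carrier ?G. int m dvd x}"
  proof (intro Set.set_eqI iffI)
    fix x assume "x \<in> mod_progression (M * m) m M"
    then obtain i where "i < M" "x = int (i * m)"
      using mod_progression_eq_multiples[OF assms] by auto
    moreover from this assms have "int (i * m) < int (M * m)" by auto
    ultimately show "x \<in> {x \<in> carrier ?G. int m dvd x}"
      using assms by (simp add: carrier_integer_mod_group)
  next
    fix x assume x: "x \<in> {x \<in> carrier ?G. int m dvd x}"
    then have "0 \<le> x" "x < int (M * m)" "int m dvd x"
      using assms by (auto simp: carrier_integer_mod_group)
    then obtain i where i: "nat x = i * m"
      by (metis dvd_def int_dvd_int_iff mult.commute nat_0_le)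
    moreover have "i < M" using i assms \<open>x < int (M * m)\<close> \<open>0 \<le> x\<close>
      by (metis mult_less_cancel2 nat_less_iff)
    ultimately show "x \<in> mod_progression (M * m) m M"
      using \<open>0 \<le> x\<close> mod_progression_eq_multiples[OF assms] by (metis imageI int_nat_eq lessThan_iff)
  qed
  show ?thesis
    unfolding H
  proof (rule group.subgroupI[OF group_integer_mod_group])
    have "0 \<in> {x \<in> carrier ?G. int m dvd x}"
      using assms by (simp add: carrier_integer_mod_group)
    then show "{x \<in> carrier ?G. int m dvd x} \<noteq> {}" by blast
  qed (use assms in \<open>auto simp: carrier_integer_mod_group dvd_mod\<close>)
qed

section \<open>The factorization of the subgroup of multiples\<close>

lemma cong_drop_multiples:
  fixes u v x y p q :: nat
  assumes "[u + x = v + y] (mod p * q)" "p dvd u" "p dvd v"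
  shows "[x = y] (mod p)"
  using cong_modulus_mult_nat[OF assms(1)] assms(2,3) by (auto simp: cong_def elim!: dvdE)

text \<open>
  Reduction modulo \<open>a * b\<close> kills the terms in \<open>i\<close> and \<open>k\<close> and leaves \<open>j * (c * d) + l * a\<close>, whose
  digits are read off modulo \<open>a\<close>, where \<open>c * d\<close> is invertible, and then modulo \<open>a * b\<close>. What remains,
  \<open>(i + k * c) * (a * b)\<close>, is a mixed-radix expansion below the modulus.
\<close>

lemma mixed_digits_unique:
  fixes a b c d :: nat
  assumes co: "coprime a (c * d)"
    and i: "i < c" "i' < c" and j: "j < a" "j' < a" and k: "k < d" "k' < d" and l: "l < b" "l' < b"
    and eq: "[(i * (a * b) + j * (c * d)) + (k * (a * c * b) + l * a) =
              (i' * (a * b) + j' * (c * d)) + (k' * (a * c * b) + l' * a)] (mod a * b * c * d)"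
  shows "i = i' \<and> j = j' \<and> k = k' \<and> l = l'"
proof -
  have pos: "a > 0" "b > 0" "c > 0" "d > 0" using i j k l by auto
  let ?h = "\<lambda>i k. (i + k * c) * (a * b)"
  have eq2: "[?h i k + (j * (c * d) + l * a) = ?h i' k' + (j' * (c * d) + l' * a)] (mod (a * b) * (c * d))"
    using eq by (simp add: algebra_simps)
  then have ab: "[j * (c * d) + l * a = j' * (c * d) + l' * a] (mod a * b)"
    by (rule cong_drop_multiples) simp_all
  then have "[l * a + j * (c * d) = l' * a + j' * (c * d)] (mod a * b)"
    by (simp only: add.commute)
  then have "[j * (c * d) = j' * (c * d)] (mod a)"
    by (rule cong_drop_multiples) simp_all
  then have j_eq: "j = j'"
    using co j by (metis cong_less_modulus_unique_nat cong_mult_rcancel_nat coprime_commute)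
  then have "[l * a = l' * a] (mod a * b)"
    using ab by (simp add: cong_add_lcancel_nat)
  moreover have "l * a < a * b" "l' * a < a * b" using l pos by auto
  ultimately have l_eq: "l = l'"
    using pos by (auto dest: cong_less_modulus_unique_nat)
  have bound: "x + y * c < c * d" if "x < c" "y < d" for x y
  proof -
    have "x + y * c < Suc y * c" using that by simp
    also have "\<dots> \<le> d * c" using that by (intro mult_le_mono1) simp
    finally show ?thesis by (simp add: mult.commute)
  qed
  have "[?h i k = ?h i' k'] (mod (a * b) * (c * d))"
    using eq2 j_eq l_eq by (simp add: cong_add_rcancel_nat)
  moreover have "?h i k < (a * b) * (c * d)" "?h i' k' < (a * b) * (c * d)"
    using bound i k pos by simp_all
  ultimately have "i + k * c = i' + k' * c"
    using pos by (auto dest: cong_less_modulus_unique_nat)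
  then have "(i + k * c) mod c = (i' + k' * c) mod c" "(i + k * c) div c = (i' + k' * c) div c"
    by simp_all
  then show ?thesis using i j_eq l_eq by simp
qed

lemma factorization_of_multiples:
  fixes a b c d m :: nat
  assumes pos: "a > 0" "b > 0" "c > 0" "d > 0" "m > 0" and co: "coprime a (c * d)"
    and N: "N = a * b * c * d * m"
  shows "factorization (integer_mod_group N\<lparr>carrier := mod_progression N m (a * b * c * d)\<rparr>)
    (mod_progression N (a * b * m) c <#>\<^bsub>integer_mod_group N\<^esub> mod_progression N (c * d * m) a)
    (mod_progression N (a * c * b * m) d <#>\<^bsub>integer_mod_group N\<^esub> mod_progression N (a * m) b)"
proof -
  define M where "M = a * b * c * d"
  have M: "N = M * m" "M > 0" using N pos by (simp_all add: M_def)
  let ?G = "integer_mod_group N" and ?H = "mod_progression N m M"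
  let ?I = "{..<c} \<times> {..<a}" and ?J = "{..<d} \<times> {..<b}"
  define f where "f = (\<lambda>(i, j). i * (a * b) + j * (c * d))"
  define g where "g = (\<lambda>(k, l). k * (a * c * b) + l * a)"
  define F where "F = (\<lambda>p. int (f p * m) mod int N)"
  define E where "E = (\<lambda>p. int (g p * m) mod int N)"
  have scale: "int (x * m) mod int N = int (x mod M * m)" for x
    by (simp add: M(1) mult_mod_left flip: of_nat_mod of_nat_mult)
  have H: "?H = (\<lambda>i. int (i * m)) ` {..<M}"
    using mod_progression_eq_multiples[OF \<open>m > 0\<close> \<open>M > 0\<close>] M by simp
  have FE: "F p \<in> ?H" "E q \<in> ?H" for p q
    unfolding F_def E_def scale H by (rule imageI, use M in simp)+
  have inj: "inj_on (\<lambda>(p, q). (f p + g q) mod M) (?I \<times> ?J)"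
  proof (rule inj_onI, clarsimp)
    fix i j k l i' j' k' l'
    assume "i < c" "j < a" "k < d" "l < b" "i' < c" "j' < a" "k' < d" "l' < b"
      and "(f (i, j) + g (k, l)) mod M = (f (i', j') + g (k', l')) mod M"
    then show "i = i' \<and> j = j' \<and> k = k' \<and> l = l'"
      by (intro mixed_digits_unique[OF co]) (simp_all add: cong_def f_def g_def M_def)
  qed
  \<comment> \<open>There are as many digit vectors as residues, so injectivity already gives surjectivity.\<close>
  have "card (?I \<times> ?J) = card {..<M}" by (simp add: M_def)
  moreover have "(\<lambda>(p, q). (f p + g q) mod M) ` (?I \<times> ?J) \<subseteq> {..<M}" using M by auto
  ultimately have "bij_betw (\<lambda>(p, q). (f p + g q) mod M) (?I \<times> ?J) {..<M}"
    unfolding bij_betw_def by (intro conjI inj card_subset_eq) (simp_all only: card_image[OF inj] finite_lessThan)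
  moreover have "bij_betw (\<lambda>i. int (i * m)) {..<M} ?H"
    using H pos by (auto simp: bij_betw_def inj_on_def)
  ultimately have "bij_betw ((\<lambda>i. int (i * m)) \<circ> (\<lambda>(p, q). (f p + g q) mod M)) (?I \<times> ?J) ?H"
    by (rule bij_betw_trans)
  moreover have "((\<lambda>i. int (i * m)) \<circ> (\<lambda>(p, q). (f p + g q) mod M)) =
      (\<lambda>(p, q). F p \<otimes>\<^bsub>?G\<lparr>carrier := ?H\<rparr>\<^esub> E q)"
  proof (intro ext, clarify)
    fix p q
    have "F p \<otimes>\<^bsub>?G\<lparr>carrier := ?H\<rparr>\<^esub> E q = int ((f p + g q) * m) mod int N"
      by (simp add: F_def E_def mod_simps distrib_right)
    then show "((\<lambda>i. int (i * m)) \<circ> (\<lambda>(p, q). (f p + g q) mod M)) (p, q) =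
        F p \<otimes>\<^bsub>?G\<lparr>carrier := ?H\<rparr>\<^esub> E q"
      by (simp only: scale) simp
  qed
  ultimately have "bij_betw (\<lambda>(p, q). F p \<otimes>\<^bsub>?G\<lparr>carrier := ?H\<rparr>\<^esub> E q) (?I \<times> ?J)
      (carrier (?G\<lparr>carrier := ?H\<rparr>))"
    by simp
  then have "factorization (?G\<lparr>carrier := ?H\<rparr>) (F ` ?I) (E ` ?J)"
    using FE pos by (intro factorization_if_bij_betw) (auto simp: image_subset_iff)
  moreover have "mod_progression N (a * b * m) c <#>\<^bsub>?G\<^esub> mod_progression N (c * d * m) a = F ` ?I"
    unfolding set_mult_mod_progression by (intro image_cong) (auto simp: F_def f_def algebra_simps)
  moreover have "mod_progression N (a * c * b * m) d <#>\<^bsub>?G\<^esub> mod_progression N (a * m) b = E ` ?J"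
    unfolding set_mult_mod_progression by (intro image_cong) (auto simp: E_def g_def algebra_simps)
  ultimately show ?thesis by (simp add: M_def)
qed

section \<open>Non-periodicity of the first factor\<close>

text \<open>
  If the first digit \<open>x\<close> of the period is positive, adding the period to the element of \<open>S\<close> with digits
  \<open>c - x\<close> and \<open>0\<close> produces the first digit \<open>c\<close>. First digits are determined modulo \<open>c * d\<close>, because
  \<open>a * b\<close> is invertible there. Since \<open>x > 0\<close> forces \<open>d \<ge> 2\<close>, the number \<open>c < c * d\<close> is congruent to none
  of the admissible digits \<open>0, \<dots>, c - 1\<close>.
\<close>

lemma period_first_digit_zero:
  fixes a b c d m :: nat
  assumes m: "m > 0" and co: "coprime (a * b) (c * d)" and cd: "c = 1 \<or> d \<ge> 2"
    and N: "N = a * b * c * d * m" and S: "S = mod_progression N (a * b * m) c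
      <#>\<^bsub>integer_mod_group N\<^esub> mod_progression N (c * d * m) a"
    and x: "x < c" and y: "y < a" and g: "g = int ((x * (a * b) + y * (c * d)) * m) mod int N"
    and period: "S #>\<^bsub>integer_mod_group N\<^esub> g \<subseteq> S"
  shows "x = 0"
proof (rule ccontr)
  assume "x \<noteq> 0"
  then have "c < c * d" using x cd by auto
  have S': "S = (\<lambda>(i, j). int ((i * (a * b) + j * (c * d)) * m) mod int N) ` ({..<c} \<times> {..<a})"
    unfolding S set_mult_mod_progression by (intro image_cong) (auto simp: algebra_simps)
  have "int (((c - x) * (a * b) + 0 * (c * d)) * m) mod int N \<in> S"
    unfolding S' using x y \<open>x \<noteq> 0\<close> by (intro rev_image_eqI[of "(c - x, 0)"]) auto
  then have "(int (((c - x) * (a * b) + 0 * (c * d)) * m) mod int N + g) mod int N \<in> S"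
    using period by (auto simp: r_coset_def)
  moreover have "(int (((c - x) * (a * b) + 0 * (c * d)) * m) mod int N + g) mod int N =
      int ((((c - x) + x) * (a * b) + y * (c * d)) * m) mod int N"
    unfolding g mod_add_eq by (simp only: of_nat_add[symmetric]) (simp add: algebra_simps)
  ultimately obtain i j where ij: "i < c"
    "int ((c * (a * b) + y * (c * d)) * m) mod int N = int ((i * (a * b) + j * (c * d)) * m) mod int N"
    using x unfolding S' by auto
  then have "((c * (a * b) + y * (c * d)) * m) mod (a * b * (c * d) * m) =
      ((i * (a * b) + j * (c * d)) * m) mod (a * b * (c * d) * m)"
    by (simp only: N of_nat_mod[symmetric] of_nat_eq_iff mult.assoc)
  then have "[y * (c * d) + c * (a * b) = j * (c * d) + i * (a * b)] (mod c * d * (a * b))"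
    using m by (simp add: cong_def flip: mult_mod_left) (simp add: mult.commute add.commute)
  then have "[c * (a * b) = i * (a * b)] (mod c * d)"
    by (rule cong_drop_multiples) simp_all
  then have "[c = i] (mod c * d)"
    using co by (simp add: cong_mult_rcancel_nat)
  then show False
    using cong_less_modulus_unique_nat[of c i "c * d"] ij(1) \<open>c < c * d\<close> by simp
qed

text \<open>
  A period of a set containing \<open>0\<close> is an element of the set; both its digits vanish, the second one
  by exchanging the two progressions.
\<close>

lemma sum_of_progressions_not_periodic:
  fixes a b c d m :: nat
  assumes pos: "a > 0" "c > 0" "m > 0" and co: "coprime (a * b) (c * d)"
    and ab: "a = 1 \<or> b \<ge> 2" and cd: "c = 1 \<or> d \<ge> 2" and N: "N = a * b * c * d * m"
  shows "\<not> periodic (integer_mod_group N) (mod_progression N (a * b * m) c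
    <#>\<^bsub>integer_mod_group N\<^esub> mod_progression N (c * d * m) a)" (is "\<not> periodic ?G ?S")
proof
  assume "periodic ?G ?S"
  then obtain g where g: "g \<in> carrier ?G" "g \<noteq> 0" "?S #>\<^bsub>?G\<^esub> g = ?S"
    by (auto simp: periodic_def)
  have S: "?S = (\<lambda>(i, j). int ((i * (a * b) + j * (c * d)) * m) mod int N) ` ({..<c} \<times> {..<a})"
    unfolding set_mult_mod_progression by (intro image_cong) (auto simp: algebra_simps)
  have "0 \<in> ?S"
    unfolding S using pos by (intro rev_image_eqI[of "(0, 0)"]) auto
  then have "(0 + g) mod int N \<in> ?S #>\<^bsub>?G\<^esub> g" by (force simp: r_coset_def)
  then have "g \<in> ?S"
    using g by (auto simp: carrier_integer_mod_group split: if_splits)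
  then obtain x y where xy: "x < c" "y < a" "g = int ((x * (a * b) + y * (c * d)) * m) mod int N"
    unfolding S by auto
  have "x = 0"
    by (rule period_first_digit_zero[OF pos(3) co cd N refl xy]) (use g in simp)
  moreover have "y = 0"
  proof (rule period_first_digit_zero[OF pos(3) _ ab _ _ xy(2,1)])
    show "coprime (c * d) (a * b)" using co by (simp add: coprime_commute)
    show "N = c * d * a * b * m" by (simp add: N)
    show "?S = mod_progression N (c * d * m) a <#>\<^bsub>?G\<^esub> mod_progression N (a * b * m) c"
      by (rule set_mult_mod_progression_commute)
    show "g = int ((y * (c * d) + x * (a * b)) * m) mod int N" using xy(3) by (simp add: add.commute)
    show "?S #>\<^bsub>?G\<^esub> g \<subseteq> ?S" using g by simp
  qed
  ultimately show False using xy(3) g(2) by simp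
qed

section \<open>The Vuza canon\<close>

(* If n3 = 1 and n2 > 1, then A is a non-trivial subgroup, so S = A + B is periodic and cannot be part
   of a Vuza canon, while R can be non-periodic, e.g. for (p1, p2, n1, n2, n3) = (3, 2, 1, 2, 1),
   K1 = {0}, K2 = {1}: S = {0, 6} and R = {0, 1, 2, 4, 5, 9} in the cyclic group of order 12.
   The assumption nontriv excludes exactly these parameters. *)

theorem theorem16:
  fixes p1 p2 n1 n2 n3 N :: nat
    and G :: "int monoid"
    and H K K1 K2 A B U V U' V' S R :: "int set"
  assumes primes: "prime p1" "prime p2" "p1 \<noteq> p2"
    and pos: "n1 > 0" "n2 > 0" "n3 > 0"
    and coprime: "coprime (n1 * p1) (n2 * p2)" "coprime (n1 * p1) (n2 * n3)"
    and nontriv: "n2 = 1 \<or> n3 \<ge> 2"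
    and N: "N = n1 * n2 * n3 * p1 * p2"
    and G: "G = integer_mod_group N"
    and H: "H = mod_progression N p2 (n1 * n2 * n3 * p1)"
    and K: "coset_representatives G H K" "K = K1 \<union> K2" "K1 \<inter> K2 = {}"
    and A: "A = mod_progression N (n1 * p1 * p2) n2"
    and B: "B = mod_progression N (n2 * n3 * p2) n1"
    and U: "U = mod_progression N (n1 * n2 * p1 * p2) n3"
    and V: "V = mod_progression N (n1 * n2 * n3 * p2) p1"
    and U': "U' = mod_progression N (n2 * p2) n3"
    and V': "V' = mod_progression N (n1 * p2) p1"
    and S: "S = A <#>\<^bsub>G\<^esub> B"
    and R: "R = (U <#>\<^bsub>G\<^esub> V' <#>\<^bsub>G\<^esub> K1) \<union> (U' <#>\<^bsub>G\<^esub> V <#>\<^bsub>G\<^esub> K2)"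
    and R_nonperiodic: "\<not> periodic G R"
  shows "vuza_canon G S R"
proof -
  define M where "M = n1 * n2 * n3 * p1"
  have ge2: "p1 \<ge> 2" "p2 \<ge> 2" using primes by (auto dest: prime_ge_2_nat)
  have M: "N = M * p2" "M > 0" and "N > 0" using N pos ge2 by (auto simp: M_def)
  have co: "coprime n1 (n2 * n3)" "coprime n2 (n1 * p1)" "coprime (n1 * p1) (n2 * n3)"
    using coprime by (auto simp: coprime_commute)
  interpret comm_group G by (simp add: G)
  have H_subgroup: "subgroup H G"
    using subgroup_mod_progression[of p2 M] M ge2 by (simp add: H G flip: M_def)
  have "factorization (G\<lparr>carrier := H\<rparr>) S (U <#>\<^bsub>G\<^esub> V')"
    using factorization_of_multiples[of n1 p1 n2 n3 p2 N] pos ge2 co N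
    by (simp add: S A B U V' H G mult_ac)
  \<comment> \<open>Exchanging the roles of \<open>(n1, p1)\<close> and \<open>(n2, n3)\<close> exchanges \<open>A\<close> with \<open>B\<close>, \<open>U\<close> with \<open>V\<close> and
    \<open>V'\<close> with \<open>U'\<close>.\<close>
  moreover have "factorization (G\<lparr>carrier := H\<rparr>) (B <#>\<^bsub>G\<^esub> A) (V <#>\<^bsub>G\<^esub> U')"
    using factorization_of_multiples[of n2 n3 n1 p1 p2 N] pos ge2 co N
    by (simp add: A B V U' H G mult_ac)
  moreover have "B <#>\<^bsub>G\<^esub> A = S" "V <#>\<^bsub>G\<^esub> U' = U' <#>\<^bsub>G\<^esub> V"
    unfolding S A B V U' G by (rule set_mult_mod_progression_commute)+
  ultimately have "factorization G S
      (\<Union>k\<in>K. (if k \<in> K1 then U <#>\<^bsub>G\<^esub> V' else U' <#>\<^bsub>G\<^esub> V) #>\<^bsub>G\<^esub> k)"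
    by (intro factorization_glued_from_cosets[OF is_group H_subgroup K(1)]) auto
  moreover have "(\<Union>k\<in>K. (if k \<in> K1 then U <#>\<^bsub>G\<^esub> V' else U' <#>\<^bsub>G\<^esub> V) #>\<^bsub>G\<^esub> k) = R"
  proof -
    have set_mult: "X <#>\<^bsub>G\<^esub> Y = (\<Union>k\<in>Y. X #>\<^bsub>G\<^esub> k)" for X Y
      by (auto simp: set_mult_def r_coset_def)
    show ?thesis
      unfolding R K(2) set_mult[of "U <#>\<^bsub>G\<^esub> V'"] set_mult[of "U' <#>\<^bsub>G\<^esub> V"]
      unfolding UN_Un using K(3) by (intro arg_cong2[of _ _ _ _ "(\<union>)"] SUP_cong) (auto simp: disjoint_iff)
  qed
  moreover have "\<not> periodic G S"
    using sum_of_progressions_not_periodic[of n1 n2 p2 p1 n3 N] pos ge2 co nontriv N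
    by (simp add: S A B G mult_ac)
  ultimately show ?thesis
    using R_nonperiodic by (simp add: vuza_canon_def)
qed

end
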